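(* Let $Y$ be an invariant set and let $X$ be a finitely supported subset of $Y$ that is not FSM uniformly infinite. (1) If $f:\wp_{us}(X)\to\wp_{us}(X)$ is finitely supported and satisfies $Z\subseteq f(Z)$ for all $Z\in\wp_{us}(X)$, then for each $Z\in\wp_{us}(X)$ there exists $m\in\mathbb N$ such that $f^m(Z)$ is a fixed point of $f$. (2) If $f:\wp_{fin}(X)\to\wp_{fin}(X)$ is finitely supported and satisfies $Z\subseteq f(Z)$ for all $Z\in\wp_{fin}(X)$, then for each $Z\in\wp_{fin}(X)$ there exists $m\in\mathbb N$ such that $f^m(Z)$ is a fixed point of $f$.
   Context: Fix an infinite set $A$ of atoms. $S_A$ is the group of bijections of $A$ that are compositions of finitely many transpositions. An $S_A$-set is a set with a group action $\cdot$ of $S_A$. For $S\subseteq A$, $Fix(S)=\{\pi\in S_A:\pi(a)=a\ \forall a\in S\}$; $S$ supports $x$ if $\pi\cdot x=x$ for all $\pi\in Fix(S)$; the least finite supporting set of $x$ is $supp(x)$. An invariant set is an $S_A$-set all of whose elements have finite supporting sets. Powersets carry $\pi\star Z=\{\pi\cdot z:z\in Z\}$; $\wp_{fs}(Y)$ is the set of subsets of $Y$ finitely supported under $\star$; its elements are the finitely supported subsets of $Y$. Cartesian products carry the componentwise action. A set is uniformly supported if one finite $S\subseteq A$ supports all its elements. For $X\in\wp_{fs}(Y)$: $\wp_{us}(X)$ is the set of uniformly supported subsets of $X$ (including $\emptyset$) and $\wp_{fin}(X)$ the set of finite subsets of $X$; both are subsets of $\wp_{fs}(Y)$ supported by $supp(X)$.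 $X$ is FSM uniformly infinite if it has an infinite uniformly supported subset. A function $f:Z\to T$ between finitely supported subsets of invariant sets $U,V$ is finitely supported if its graph is a finitely supported subset of $U\times V$; equivalently a finite $S$ supports $f$ iff for all $\pi\in Fix(S)$, $x\in Z$: $\pi\cdot x\in Z$, $\pi\cdot f(x)\in T$, $f(\pi\cdot x)=\pi\cdot f(x)$. *)

theory Defs
  imports "HOL-Combinatorics.Permutations" "HOL-Algebra.Group_Action"
begin

text \<open>
  The set of atoms is an arbitrary carrier set \<open>A\<close>; infinity of \<open>A\<close> is assumed where it is used.
  \<^const>\<open>permutation\<close> says that \<open>p\<close> is a composition of finitely many transpositions; if
  moreover \<open>p permutes A\<close>, these can be taken within \<open>A\<close>. As elsewhere in the library, permutations of \<open>A\<close> are functions on the whole type that are the identity outside \<open>A\<close>.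
\<close>

definition finsym :: "'a set \<Rightarrow> ('a \<Rightarrow> 'a) monoid"
  where "finsym A = \<lparr>carrier = {p. p permutes A \<and> permutation p}, mult = (\<circ>), one = id\<rparr>"

definition Fix :: "'a set \<Rightarrow> 'a set \<Rightarrow> ('a \<Rightarrow> 'a) set"
  where "Fix A S = {p \<in> carrier (finsym A). \<forall>a\<in>S. p a = a}"

definition supports :: "'a set \<Rightarrow> (('a \<Rightarrow> 'a) \<Rightarrow> 'b \<Rightarrow> 'b) \<Rightarrow> 'a set \<Rightarrow> 'b \<Rightarrow> bool"
  where "supports A \<phi> S x \<longleftrightarrow> S \<subseteq> A \<and> (\<forall>p\<in>Fix A S. \<phi> p x = x)"

definition fin_supported :: "'a set \<Rightarrow> (('a \<Rightarrow> 'a) \<Rightarrow> 'b \<Rightarrow> 'b) \<Rightarrow> 'b \<Rightarrow> bool"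
  where "fin_supported A \<phi> x \<longleftrightarrow> (\<exists>S. finite S \<and> supports A \<phi> S x)"

text \<open>
  A set \<open>Y\<close> with an action of \<open>finsym A\<close> is given by the library locale \<^locale>\<open>group_action\<close>, in which
  \<open>\<phi> p\<close> is an extensional bijection of \<open>Y\<close> (undefined outside \<open>Y\<close>). All derived actions
  below are therefore restricted to their carriers.
\<close>

locale invariant_set = group_action "finsym A" Y \<phi>
  for A :: "'a set" and Y :: "'b set" and \<phi> +
  assumes elements_fin_supported: "y \<in> Y \<Longrightarrow> fin_supported A \<phi> y"

definition Pow_action :: "'b set \<Rightarrow> (('a \<Rightarrow> 'a) \<Rightarrow> 'b \<Rightarrow> 'b) \<Rightarrow> ('a \<Rightarrow> 'a) \<Rightarrow> 'b set \<Rightarrow> 'b set"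
  where "Pow_action Y \<phi> = (\<lambda>p. \<lambda>Z\<in>Pow Y. \<phi> p ` Z)"

definition Pow_fs :: "'a set \<Rightarrow> 'b set \<Rightarrow> (('a \<Rightarrow> 'a) \<Rightarrow> 'b \<Rightarrow> 'b) \<Rightarrow> 'b set set"
  where "Pow_fs A Y \<phi> = {Z \<in> Pow Y. fin_supported A (Pow_action Y \<phi>) Z}"

definition Pow_fs_action ::
    "'a set \<Rightarrow> 'b set \<Rightarrow> (('a \<Rightarrow> 'a) \<Rightarrow> 'b \<Rightarrow> 'b) \<Rightarrow> ('a \<Rightarrow> 'a) \<Rightarrow> 'b set \<Rightarrow> 'b set"
  where "Pow_fs_action A Y \<phi> = (\<lambda>p. restrict (Pow_action Y \<phi> p) (Pow_fs A Y \<phi>))"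

definition prod_action ::
    "'b set \<Rightarrow> (('a \<Rightarrow> 'a) \<Rightarrow> 'b \<Rightarrow> 'b) \<Rightarrow> 'c set \<Rightarrow> (('a \<Rightarrow> 'a) \<Rightarrow> 'c \<Rightarrow> 'c) \<Rightarrow>
     ('a \<Rightarrow> 'a) \<Rightarrow> 'b \<times> 'c \<Rightarrow> 'b \<times> 'c"
  where "prod_action U \<phi> V \<psi> = (\<lambda>p. \<lambda>(x, y)\<in>U \<times> V. (\<phi> p x, \<psi> p y))"

definition uniformly_supported :: "'a set \<Rightarrow> (('a \<Rightarrow> 'a) \<Rightarrow> 'b \<Rightarrow> 'b) \<Rightarrow> 'b set \<Rightarrow> bool"
  where "uniformly_supported A \<phi> Z \<longleftrightarrow> (\<exists>S. finite S \<and> (\<forall>z\<in>Z. supports A \<phi> S z))"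

definition Pow_us :: "'a set \<Rightarrow> (('a \<Rightarrow> 'a) \<Rightarrow> 'b \<Rightarrow> 'b) \<Rightarrow> 'b set \<Rightarrow> 'b set set"
  where "Pow_us A \<phi> X = {Z \<in> Pow X. uniformly_supported A \<phi> Z}"

definition FSM_uniformly_infinite :: "'a set \<Rightarrow> (('a \<Rightarrow> 'a) \<Rightarrow> 'b \<Rightarrow> 'b) \<Rightarrow> 'b set \<Rightarrow> bool"
  where "FSM_uniformly_infinite A \<phi> X \<longleftrightarrow> (\<exists>Z\<subseteq>X. infinite Z \<and> uniformly_supported A \<phi> Z)"

text \<open>
  \<open>Z\<close> and \<open>T\<close> are meant to be finitely supported subsets of the invariant sets \<open>U\<close> and \<open>V\<close>.
  The values of \<open>f\<close> outside \<open>Z\<close> play no role.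
\<close>

definition fin_supported_fun ::
    "'a set \<Rightarrow> 'b set \<Rightarrow> (('a \<Rightarrow> 'a) \<Rightarrow> 'b \<Rightarrow> 'b) \<Rightarrow> 'c set \<Rightarrow> (('a \<Rightarrow> 'a) \<Rightarrow> 'c \<Rightarrow> 'c) \<Rightarrow>
     'b set \<Rightarrow> 'c set \<Rightarrow> ('b \<Rightarrow> 'c) \<Rightarrow> bool"
  where "fin_supported_fun A U \<phi> V \<psi> Z T f \<longleftrightarrow>
    f \<in> Z \<rightarrow> T \<and> (\<lambda>x. (x, f x)) ` Z \<in> Pow_fs A (U \<times> V) (prod_action U \<phi> V \<psi>)"

end

theory Submission
  imports Defs
begin

text \<open>
  A set that is not uniformly infinite has only finite uniformly supported subsets, so both parts
  concern finite sets. If a finite set \<open>S\<close> supports \<open>f\<close> and every element of \<open>Z\<close>, it supports every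
  iterate \<open>f\<^sup>n(Z)\<close> as a set. These iterates are finite, and a finite set supported by \<open>S\<close>
  consists of elements supported by \<open>S\<close>: the orbit of such an element under the permutations fixing
  \<open>S\<close> is finite. Hence the union of the increasing chain \<open>f\<^sup>n(Z)\<close> is uniformly supported,
  so it is finite, and the chain becomes stationary.
\<close>

section \<open>Permutations fixing a set of atoms\<close>

lemma Fix_subset_carrier: "Fix A S \<subseteq> carrier (finsym A)"
  by (auto simp: Fix_def)

lemma Fix_antimono: "S \<subseteq> T \<Longrightarrow> Fix A T \<subseteq> Fix A S"
  by (auto simp: Fix_def)

lemma supports_mono: "supports A \<phi> S x \<Longrightarrow> S \<subseteq> T \<Longrightarrow> T \<subseteq> A \<Longrightarrow> supports A \<phi> T x"
  using Fix_antimono[of S T A] by (auto simp: supports_def)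

lemma transpose_in_Fix:
  assumes "a \<in> A - S" "b \<in> A - S"
  shows "transpose a b \<in> Fix A S"
  using assms by (auto simp: Fix_def finsym_def permutes_swap_id permutation_swap_id transpose_def)

text \<open>A finitary permutation is a product of transpositions of points that it moves, and all
  points moved here lie in \<open>A - S\<close>. Support by \<open>S\<close> thus reduces to
  transpositions of atoms outside \<open>S\<close>.\<close>

lemma Fix_induct [consumes 1, case_names id transpose]:
  assumes "p \<in> Fix A S"
    and "P id"
    and "\<And>a b q. a \<in> A - S \<Longrightarrow> b \<in> A - S \<Longrightarrow> q \<in> carrier (finsym A) \<Longrightarrow> P q \<Longrightarrow> P (transpose a b \<circ> q)"
  shows "P p"
proof -
  let ?F = "{x. p x \<noteq> x}"
  have p: "p permutes A" "permutation p" "\<forall>a\<in>S. p a = a"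
    using assms(1) by (auto simp: Fix_def finsym_def)
  have fin: "finite ?F"
    using p(2) by (simp add: permutation)
  have sub: "?F \<subseteq> A - S"
    using p(1,3) by (auto dest: permutes_not_in)
  \<comment> \<open>Induction over transpositions needs a finite set, so \<open>A\<close> is
    replaced by the points that \<open>p\<close> moves; every swapped atom then lies outside
    \<open>S\<close>.\<close>
  have "p permutes ?F"
    using p(1) by (auto simp: permutes_def)
  from this fin have "P p \<and> p \<in> carrier (finsym A)"
  proof (induction p rule: permutes_induct)
    case id
    then show ?case
      using assms(2) permutes_id permutation_id by (simp add: finsym_def flip: id_def)
  next
    case (swap a b q)
    then have ab: "a \<in> A - S" "b \<in> A - S"
      using sub by auto
    have "transpose a b \<circ> q \<in> carrier (finsym A)"
      using swap ab by (auto simp: finsym_def permutes_compose permutes_swap_id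
          permutation_compose permutation_swap_id)
    then show ?case
      using assms(3)[OF ab] swap by blast
  qed
  then show ?thesis ..
qed

section \<open>Actions of transpositions and supports of elements of finite sets\<close>

context invariant_set
begin

lemma action_id:
  assumes "y \<in> Y"
  shows "\<phi> id y = y"
proof -
  have "\<phi> id = (\<lambda>x\<in>Y. x)"
    using id_eq_one by (simp add: finsym_def)
  then show ?thesis
    using assms by (simp only: restrict_apply')
qed

lemma action_comp:
  "y \<in> Y \<Longrightarrow> p \<in> carrier (finsym A) \<Longrightarrow> q \<in> carrier (finsym A) \<Longrightarrow> \<phi> (p \<circ> q) y = \<phi> p (\<phi> q y)"
  using composition_rule[of y p q] by (simp add: finsym_def)

text \<open>This is the identity \<open>(a b)(b c)(a b) = (a c)\<close> for distinct atoms, carried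
  over to the action.\<close>

lemma transpose_conj:
  assumes "y \<in> Y" "a \<in> A" "b \<in> A" "c \<in> A" "b \<noteq> a" "c \<noteq> a" "b \<noteq> c"
  shows "\<phi> (transpose a b) (\<phi> (transpose b c) (\<phi> (transpose a b) y)) = \<phi> (transpose a c) y"
proof -
  have carr: "transpose u v \<in> carrier (finsym A)" if "u \<in> A" "v \<in> A" for u v
    using that transpose_in_Fix[of u A "{}" v] Fix_subset_carrier by fastforce
  have "transpose b c \<circ> transpose a b \<in> carrier (finsym A)"
    using assms carr by (auto simp: finsym_def permutes_compose permutation_compose)
  then have "\<phi> (transpose a b) (\<phi> (transpose b c) (\<phi> (transpose a b) y)) =
      \<phi> (transpose a b \<circ> (transpose b c \<circ> transpose a b)) y"
    using assms(1-4) carr by (simp only: action_comp)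
  also have "transpose a b \<circ> (transpose b c \<circ> transpose a b) = transpose a c"
    using assms(5-7) by (auto simp: fun_eq_iff transpose_def)
  finally show ?thesis .
qed

lemma transpose_trans:
  assumes "y \<in> Y" "a \<in> A" "b \<in> A" "c \<in> A" "b \<noteq> a" "c \<noteq> a" "b \<noteq> c"
    and "\<phi> (transpose a b) y = y" "\<phi> (transpose b c) y = y"
  shows "\<phi> (transpose a c) y = y"
  using transpose_conj[OF assms(1-7)] assms(8,9) by simp

text \<open>For \<open>a\<close> outside \<open>S\<close>, the images of \<open>w\<close> under
  \<open>(a c)\<close> all lie in the finite set \<open>W\<close>, so two of infinitely many fresh
  \<open>c\<close> give the same image. This forces some such \<open>(a c)\<close> to fix
  \<open>w\<close>, and from there all transpositions outside \<open>S\<close> do.\<close>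

lemma setwise_supported_finite:
  assumes A: "infinite A" and W: "finite W" "W \<subseteq> Y" and S: "finite S" "S \<subseteq> A"
    and inv: "\<And>p. p \<in> Fix A S \<Longrightarrow> \<phi> p ` W = W"
    and w: "w \<in> W"
  shows "supports A \<phi> S w"
proof -
  have wY: "w \<in> Y"
    using w W by auto
  then obtain T where T: "finite T" "supports A \<phi> T w"
    using elements_fin_supported by (auto simp: fin_supported_def)
  have fresh: "\<phi> (transpose c d) w = w" if "c \<in> A - T" "d \<in> A - T" for c d
    using T(2) transpose_in_Fix[OF that] by (auto simp: supports_def)
  have invol: "\<phi> (transpose a b) (\<phi> (transpose a b) w) = w" if "a \<in> A" "b \<in> A" for a b
  proof -
    have "transpose a b \<in> carrier (finsym A)"
      using that transpose_in_Fix[of a A "{}" b] Fix_subset_carrier by fastforce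
    then show ?thesis
      using wY action_comp[of w "transpose a b" "transpose a b"] action_id by simp
  qed
  have key: "\<phi> (transpose a d) w = w"
    if a: "a \<in> A - S" and d: "d \<in> A - S - T - {a}" for a d
  proof -
    \<comment> \<open>Avoiding \<open>S\<close> keeps the images in \<open>W\<close>, avoiding
      \<open>T\<close> makes swaps within \<open>?C\<close> fix \<open>w\<close>, and removing
      \<open>a\<close> and \<open>d\<close> provides the distinctness that conjugation
      needs.\<close>
    let ?C = "A - S - T - {a, d}"
    have "infinite ?C"
      using A S T by (simp add: Diff_infinite_finite)
    moreover have "\<phi> (transpose a c) w \<in> W" if "c \<in> A - S" for c
      using inv[OF transpose_in_Fix[OF a that]] w by blast
    then have "(\<lambda>c. \<phi> (transpose a c) w) ` ?C \<subseteq> W"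
      by blast
    ultimately have "\<not> inj_on (\<lambda>c. \<phi> (transpose a c) w) ?C"
      using W(1) by (meson finite_imageD finite_subset)
    then obtain b c where bc: "b \<in> ?C" "c \<in> ?C" "b \<noteq> c"
      and eq: "\<phi> (transpose a b) w = \<phi> (transpose a c) w"
      by (auto simp: inj_on_def)
    \<comment> \<open>Conjugating by \<open>(b c)\<close>, which fixes \<open>w\<close>, shows that \<open>(b c)\<close> fixes \<open>(a b) w\<close>;
      conjugating back gives that \<open>(a c)\<close> fixes \<open>w\<close>.\<close>
    have "\<phi> (transpose c b) (\<phi> (transpose b a) (\<phi> (transpose c b) w)) = \<phi> (transpose c a) w"
      using a bc by (intro transpose_conj[OF wY]) auto
    moreover have "\<phi> (transpose c b) w = w"
      using bc by (intro fresh) auto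
    ultimately have "\<phi> (transpose b c) (\<phi> (transpose a b) w) = \<phi> (transpose a b) w"
      by (simp add: eq transpose_commute[of c b] transpose_commute[of b a] transpose_commute[of c a])
    moreover have "\<phi> (transpose a b) (\<phi> (transpose b c) (\<phi> (transpose a b) w)) = \<phi> (transpose a c) w"
      using a bc by (intro transpose_conj[OF wY]) auto
    ultimately have ac: "\<phi> (transpose a c) w = w"
      using invol[of a b] a bc by simp
    \<comment> \<open>Pigeonhole yields only some \<open>c\<close>; since \<open>c\<close> and
      \<open>d\<close> both avoid \<open>T\<close>, the result passes from \<open>c\<close> to the
      given \<open>d\<close>.\<close>
    have "\<phi> (transpose c d) w = w"
      using bc d by (intro fresh) auto
    then show ?thesis
      using a bc d by (intro transpose_trans[OF wY _ _ _ _ _ _ ac]) auto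
  qed
  have trans: "\<phi> (transpose a b) w = w" if "a \<in> A - S" "b \<in> A - S" for a b
  proof (cases "a = b")
    case True
    then show ?thesis
      using action_id wY by simp
  next
    case False
    \<comment> \<open>\<open>key\<close> wants its second atom outside \<open>T\<close>, but both
      \<open>a\<close> and \<open>b\<close> may lie in \<open>T\<close>; a fresh \<open>c\<close>
      links them.\<close>
    have "infinite (A - S - T - {a, b})"
      using A S T by (simp add: Diff_infinite_finite)
    then obtain c where c: "c \<in> A - S - T - {a, b}"
      by (metis ex_in_conv finite.emptyI)
    have "\<phi> (transpose a c) w = w" "\<phi> (transpose c b) w = w"
      using key[of a c] key[of b c] that c by (simp_all add: transpose_commute[of c b])
    then show ?thesis
      using that c False by (intro transpose_trans[OF wY, of a c b]) auto
  qed
  have "\<phi> p w = w" if "p \<in> Fix A S" for p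
    using that
  proof (induction rule: Fix_induct)
    case id
    then show ?case
      using wY by (rule action_id)
  next
    case (transpose a b q)
    have "transpose a b \<in> carrier (finsym A)"
      using transpose transpose_in_Fix[of a A S b] Fix_subset_carrier by fastforce
    then show ?case
      using transpose.IH trans[OF transpose.hyps(1,2)] action_comp[OF wY _ transpose.hyps(3)]
      by metis
  qed
  then show ?thesis
    using S by (auto simp: supports_def)
qed

section \<open>Uniformly supported subsets and finitely supported functions\<close>

lemma uniformly_supported_finite:
  assumes "finite Z" "Z \<subseteq> Y"
  obtains S where "finite S" "S \<subseteq> A" "\<And>z. z \<in> Z \<Longrightarrow> supports A \<phi> S z"
proof -
  have "\<forall>z\<in>Z. \<exists>S. finite S \<and> supports A \<phi> S z"
    using assms elements_fin_supported by (auto simp: fin_supported_def)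
  then obtain s where s: "\<And>z. z \<in> Z \<Longrightarrow> finite (s z)" "\<And>z. z \<in> Z \<Longrightarrow> supports A \<phi> (s z) z"
    by metis
  have sub: "(\<Union>z\<in>Z. s z) \<subseteq> A"
    using s(2) by (auto simp: supports_def)
  show thesis
  proof (rule that[of "\<Union>z\<in>Z. s z"])
    show "finite (\<Union>z\<in>Z. s z)"
      using s(1) assms(1) by auto
    show "supports A \<phi> (\<Union>z\<in>Z. s z) z" if "z \<in> Z" for z
      using s(2)[OF that] sub that by (blast intro: supports_mono)
  qed (fact sub)
qed

text \<open>Finite sets are uniformly supported by a union of supports, and the hypothesis on
  \<open>X\<close> excludes infinite ones. Both claims of the theorem become one about
  \<open>Fpow X\<close>.\<close>

lemma Pow_us_eq_Fpow:
  assumes "X \<subseteq> Y" "\<not> FSM_uniformly_infinite A \<phi> X"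
  shows "Pow_us A \<phi> X = Fpow X"
proof -
  have "uniformly_supported A \<phi> Z" if "finite Z" "Z \<subseteq> X" for Z
    using uniformly_supported_finite[of Z] that assms(1) unfolding uniformly_supported_def
    by (metis order_trans)
  then show ?thesis
    using assms(2) by (auto simp: Pow_us_def Fpow_def FSM_uniformly_infinite_def)
qed

text \<open>A permutation preserving the graph sends \<open>(Z, f Z)\<close> to another point of the
  graph, whose second component is determined by its first.\<close>

lemma fin_supported_fun_equivariant:
  assumes "fin_supported_fun A (Pow_fs A Y \<phi>) (Pow_fs_action A Y \<phi>)
      (Pow_fs A Y \<phi>) (Pow_fs_action A Y \<phi>) D E f"
  obtains S where "finite S" "S \<subseteq> A"
    "\<And>p Z. p \<in> Fix A S \<Longrightarrow> Z \<in> D \<Longrightarrow> f (\<phi> p ` Z) = \<phi> p ` f Z"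
proof -
  let ?P = "Pow_fs A Y \<phi>"
  let ?act = "prod_action ?P (Pow_fs_action A Y \<phi>) ?P (Pow_fs_action A Y \<phi>)"
  let ?G = "(\<lambda>x. (x, f x)) ` D"
  have G: "?G \<subseteq> ?P \<times> ?P" "fin_supported A (Pow_action (?P \<times> ?P) ?act) ?G"
    using assms by (auto simp: fin_supported_fun_def Pow_fs_def[of A "_ \<times> _"])
  then obtain S where S: "finite S" "S \<subseteq> A" "\<And>p. p \<in> Fix A S \<Longrightarrow> ?act p ` ?G = ?G"
    by (auto simp: fin_supported_def supports_def Pow_action_def)
  have "f (\<phi> p ` Z) = \<phi> p ` f Z" if p: "p \<in> Fix A S" and Z: "Z \<in> D" for p Z
  proof -
    have ZP: "Z \<in> ?P" "f Z \<in> ?P"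
      using G(1) Z by auto
    \<comment> \<open>The nested restricted actions reduce to plain images only on their
      carriers.\<close>
    then have "Z \<subseteq> Y" "f Z \<subseteq> Y"
      by (auto simp: Pow_fs_def)
    then have "?act p (Z, f Z) = (\<phi> p ` Z, \<phi> p ` f Z)"
      using ZP by (simp add: prod_action_def Pow_fs_action_def Pow_action_def)
    moreover have "?act p (Z, f Z) \<in> ?G"
      using S(3)[OF p] Z by blast
    ultimately show ?thesis
      by auto
  qed
  with S(1,2) show thesis
    by (rule that)
qed

lemma iterate_reaches_fixed_point:
  assumes A: "infinite A" and X: "X \<subseteq> Y" "\<not> FSM_uniformly_infinite A \<phi> X"
    and f: "fin_supported_fun A (Pow_fs A Y \<phi>) (Pow_fs_action A Y \<phi>)
      (Pow_fs A Y \<phi>) (Pow_fs_action A Y \<phi>) (Fpow X) (Fpow X) f"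
    and incr: "\<And>Z. Z \<in> Fpow X \<Longrightarrow> Z \<subseteq> f Z"
    and Z: "Z \<in> Fpow X"
  shows "\<exists>m. f ((f ^^ m) Z) = (f ^^ m) Z"
proof -
  obtain S where S: "finite S" "S \<subseteq> A"
    and equi: "\<And>p Z. p \<in> Fix A S \<Longrightarrow> Z \<in> Fpow X \<Longrightarrow> f (\<phi> p ` Z) = \<phi> p ` f Z"
    using fin_supported_fun_equivariant[OF f] by metis
  obtain T where T: "finite T" "T \<subseteq> A" "\<And>z. z \<in> Z \<Longrightarrow> supports A \<phi> T z"
    using uniformly_supported_finite[of Z] Z X(1) by (metis Fpow_def mem_Collect_eq order_trans)
  have ZX: "(f ^^ n) Z \<in> Fpow X" for n
    using f Z by (induction n) (auto simp: fin_supported_fun_def)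
  have inv: "\<phi> p ` (f ^^ n) Z = (f ^^ n) Z" if p: "p \<in> Fix A (S \<union> T)" for p n
  proof (induction n)
    case 0
    have "\<phi> p z = z" if "z \<in> Z" for z
      using T(3)[OF that] p Fix_antimono[of T "S \<union> T" A] by (auto simp: supports_def)
    then show ?case
      by simp
  next
    case (Suc n)
    have "p \<in> Fix A S"
      using p Fix_antimono[of S "S \<union> T" A] by auto
    then show ?case
      using equi[OF _ ZX, of p n] Suc by simp
  qed
  have supp: "supports A \<phi> (S \<union> T) z" if "z \<in> (f ^^ n) Z" for n z
  proof (rule setwise_supported_finite[OF A _ _ _ _ inv that])
    show "finite ((f ^^ n) Z)" "(f ^^ n) Z \<subseteq> Y"
      using ZX[of n] X(1) by (auto simp: Fpow_def)
  qed (use S T in auto)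
  let ?U = "\<Union>n. (f ^^ n) Z"
  have "?U \<subseteq> X"
    using ZX by (auto simp: Fpow_def)
  moreover have "uniformly_supported A \<phi> ?U"
    using supp S(1) T(1) unfolding uniformly_supported_def by blast
  ultimately have fin: "finite ?U"
    using X(2) by (auto simp: FSM_uniformly_infinite_def)
  have chain: "(f ^^ m) Z \<subseteq> (f ^^ n) Z" if "m \<le> n" for m n
    using that incr[OF ZX] lift_Suc_mono_le[of "\<lambda>n. (f ^^ n) Z" m n] by simp
  have "range (\<lambda>n. (f ^^ n) Z) \<subseteq> Pow ?U"
    by auto
  then have "finite (range (\<lambda>n. (f ^^ n) Z))"
    using fin by (meson finite_Pow_iff finite_subset)
  then have "\<not> inj (\<lambda>n. (f ^^ n) Z)"
    using finite_imageD infinite_UNIV_nat by blast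
  then obtain i j where ij: "i < j" "(f ^^ i) Z = (f ^^ j) Z"
    by (metis injI linorder_neqE_nat)
  \<comment> \<open>The next iterate is squeezed between the equal sets \<open>(f ^^ i) Z\<close>
    and \<open>(f ^^ j) Z\<close>, so \<open>i\<close> is the required index.\<close>
  have "(f ^^ Suc i) Z \<subseteq> (f ^^ j) Z"
    using ij(1) by (intro chain) simp
  then show ?thesis
    using ij(2) incr[OF ZX[of i]] by (intro exI[of _ i]) auto
qed

end

theorem theorem3p5:
  fixes A :: "'a set" and Y X :: "'b set" and \<phi> :: "('a \<Rightarrow> 'a) \<Rightarrow> 'b \<Rightarrow> 'b"
  assumes "infinite A"
    and "invariant_set A Y \<phi>"
    and "X \<in> Pow_fs A Y \<phi>"
    and "\<not> FSM_uniformly_infinite A \<phi> X"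
  shows
    "(\<forall>f :: 'b set \<Rightarrow> 'b set.
        fin_supported_fun A (Pow_fs A Y \<phi>) (Pow_fs_action A Y \<phi>) (Pow_fs A Y \<phi>) (Pow_fs_action A Y \<phi>)
          (Pow_us A \<phi> X) (Pow_us A \<phi> X) f
        \<and> (\<forall>Z \<in> Pow_us A \<phi> X. Z \<subseteq> f Z)
        \<longrightarrow> (\<forall>Z \<in> Pow_us A \<phi> X. \<exists>m :: nat. f ((f ^^ m) Z) = (f ^^ m) Z))
     \<and>
     (\<forall>f :: 'b set \<Rightarrow> 'b set.
        fin_supported_fun A (Pow_fs A Y \<phi>) (Pow_fs_action A Y \<phi>) (Pow_fs A Y \<phi>) (Pow_fs_action A Y \<phi>)
          (Fpow X) (Fpow X) f
        \<and> (\<forall>Z \<in> Fpow X. Z \<subseteq> f Z)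
        \<longrightarrow> (\<forall>Z \<in> Fpow X. \<exists>m :: nat. f ((f ^^ m) Z) = (f ^^ m) Z))"


proof -
  interpret invariant_set A Y \<phi>
    by fact
  have X: "X \<subseteq> Y"
    using assms(3) by (auto simp: Pow_fs_def)
  show ?thesis
    unfolding Pow_us_eq_Fpow[OF X assms(4)]
    by (intro conjI allI impI ballI; elim conjE; rule iterate_reaches_fixed_point[OF assms(1) X assms(4)])
      auto
qed

end
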